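(* With the polynomials $Q_{n,k}^{(a,b,c)}$, $a,b,c\in\{0,1\}$, defined in the context, the following identities of polynomials in $(x,y)$ hold. (1) From $(1,1,1)$ to $(0,1,1)$: $Q_{0,0}^{(1,1,1)}=Q_{0,0}^{(0,1,1)}$; $Q_{1,0}^{(1,1,1)}=2Q_{1,0}^{(0,1,1)}-Q_{0,0}^{(0,1,1)}$; $Q_{1,1}^{(1,1,1)}=Q_{1,1}^{(0,1,1)}$; $(2n-1)Q_{n,0}^{(1,1,1)}=(n-1)\left[Q_{n,0}^{(0,1,1)}+Q_{n-1,0}^{(0,1,1)}\right]$ for $n\ge2$; $(2n-1)Q_{n,k}^{(1,1,1)}=(n-k)\left[Q_{n,k}^{(0,1,1)}+Q_{n-1,k}^{(0,1,1)}\right]$ for $n\ge 2$, $1\le k\le n-1$; $Q_{n,n}^{(1,1,1)}=Q_{n,n}^{(0,1,1)}$ for $n\ge2$. (2) From $(1,1,1)$ to $(1,0,1)$: $Q_{0,0}^{(1,1,1)}=Q_{0,0}^{(1,0,1)}$; $Q_{1,0}^{(1,1,1)}=-2Q_{1,0}^{(1,0,1)}+Q_{0,0}^{(1,0,1)}$; $Q_{1,1}^{(1,1,1)}=2Q_{1,1}^{(1,0,1)}+Q_{1,0}^{(1,0,1)}-Q_{0,0}^{(1,0,1)}$; $(2n-1)Q_{n,0}^{(1,1,1)}=(n-1)\left[-Q_{n,0}^{(1,0,1)}+Q_{n-1,0}^{(1,0,1)}\right]$ for $n\ge2$; $(2n-1)Q_{n,1}^{(1,1,1)}=2(n+1)Q_{n,1}^{(1,0,1)}+(n-1)Q_{n,0}^{(1,0,1)}-2(n-1)Q_{n-1,1}^{(1,0,1)}-(n-1)Q_{n-1,0}^{(1,0,1)}$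 for $n\ge2$; $(2n-1)(2k-1)Q_{n,k}^{(1,1,1)}=(n+k)(k-1)Q_{n,k}^{(1,0,1)}-(n-k)(k-1)Q_{n,k-1}^{(1,0,1)}-(n-k)(k-1)Q_{n-1,k}^{(1,0,1)}+(n+k-2)(k-1)Q_{n-1,k-1}^{(1,0,1)}$ for $2\le k\le n-1$; $(2n-1)Q_{n,n}^{(1,1,1)}=(n-1)\left[Q_{n,n}^{(1,0,1)}-Q_{n,n-1}^{(1,0,1)}+Q_{n-1,n-1}^{(1,0,1)}\right]$ for $n\ge2$. (3) From $(1,1,1)$ to $(1,1,0)$: $Q_{0,0}^{(1,1,1)}=Q_{0,0}^{(1,1,0)}$; $Q_{1,0}^{(1,1,1)}=-2Q_{1,0}^{(1,1,0)}+Q_{0,0}^{(1,1,0)}$; $Q_{1,1}^{(1,1,1)}=-2Q_{1,1}^{(1,1,0)}-Q_{1,0}^{(1,1,0)}+Q_{0,0}^{(1,1,0)}$; $(2n-1)Q_{n,0}^{(1,1,1)}=(n-1)\left[-Q_{n,0}^{(1,1,0)}+Q_{n-1,0}^{(1,1,0)}\right]$ for $n\ge2$; $(2n-1)Q_{n,1}^{(1,1,1)}=-2(n+1)Q_{n,1}^{(1,1,0)}-(n-1)Q_{n,0}^{(1,1,0)}+2(n-1)Q_{n-1,1}^{(1,1,0)}+(n-1)Q_{n-1,0}^{(1,1,0)}$ for $n\ge2$; $(2n-1)(2k-1)Q_{n,k}^{(1,1,1)}=-(n+k)(k-1)Q_{n,k}^{(1,1,0)}-(n-k)(k-1)Q_{n,k-1}^{(1,1,0)}+(n-k)(k-1)Q_{n-1,k}^{(1,1,0)}+(n+k-2)(k-1)Q_{n-1,k-1}^{(1,1,0)}$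 for $2\le k\le n-1$; $(2n-1)Q_{n,n}^{(1,1,1)}=(n-1)\left[-Q_{n,n}^{(1,1,0)}-Q_{n,n-1}^{(1,1,0)}+Q_{n-1,n-1}^{(1,1,0)}\right]$ for $n\ge2$.
   Context: Let $P_k^{(\alpha,\beta)}$ denote the classical degree-$k$ Jacobi polynomial on $[-1,1]$ (standard normalization $P_k^{(\alpha,\beta)}(1)=\binom{k+\alpha}{k}$), and let $\tilde P_k^{(\alpha,\beta)}(x)=P_k^{(\alpha,\beta)}(2x-1)$ be the shifted Jacobi polynomial on $[0,1]$. For $a,b,c>-1$ and integers $n\ge k\ge 0$ the Jacobi polynomials on the triangle are $$P_{n,k}^{(a,b,c)}(x,y)=\tilde P_{n-k}^{(2k+b+c+1,a)}(x)\,(1-x)^k\,\tilde P_k^{(c,b)}\!\left(\tfrac{y}{1-x}\right),$$ and $P_{n,k}:=P_{n,k}^{(0,0,0)}$. These are polynomials in $x,y$. Put $z:=1-x-y$. Two-edge Dirichlet bases (for $n\ge1$ in all lines except the $Q_{0,0}$ ones): - $Q_{0,0}^{(1,1,0)}:=1$; $Q_{n,0}^{(1,1,0)}:=x\,\tilde P_{n-1}^{(0,1)}(x)$; $Q_{n,k}^{(1,1,0)}:=xy\,P_{n-2,k-1}^{(1,1,0)}$ for $1\le k\le n-1$; $Q_{n,n}^{(1,1,0)}:=y\,P_{n-1,n-1}^{(0,1,0)}$. - $Q_{0,0}^{(1,0,1)}:=1$; $Q_{n,0}^{(1,0,1)}:=x\,\tilde P_{n-1}^{(0,1)}(x)$;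 $Q_{n,k}^{(1,0,1)}:=xz\,P_{n-2,k-1}^{(1,0,1)}$ for $1\le k\le n-1$; $Q_{n,n}^{(1,0,1)}:=z\,P_{n-1,n-1}^{(0,0,1)}$. - $Q_{0,0}^{(0,1,1)}:=1$; $Q_{n,0}^{(0,1,1)}:=(1-x)P_{n-1,0}=(1-x)\tilde P_{n-1}^{(1,0)}(x)$; $Q_{n,1}^{(0,1,1)}:=(1-x-2y)P_{n-1,0}=(1-x-2y)\tilde P_{n-1}^{(1,0)}(x)$; $Q_{n,k}^{(0,1,1)}:=yz\,P_{n-2,k-2}^{(0,1,1)}$ for $2\le k\le n$. Three-edge Dirichlet basis: $Q_{0,0}^{(1,1,1)}:=1$; $Q_{1,0}^{(1,1,1)}:=1-2x$; $Q_{1,1}^{(1,1,1)}:=1-x-2y$; and for $n\ge2$: $Q_{n,0}^{(1,1,1)}:=x(1-x)P_{n-2,0}^{(1,0,0)}=x(1-x)\tilde P_{n-2}^{(1,1)}(x)$; $Q_{n,1}^{(1,1,1)}:=x(1-x-2y)P_{n-2,0}^{(1,0,0)}=x(1-x-2y)\tilde P_{n-2}^{(1,1)}(x)$; $Q_{n,k}^{(1,1,1)}:=xyz\,P_{n-3,k-2}^{(1,1,1)}$ for $2\le k\le n-1$; $Q_{n,n}^{(1,1,1)}:=yz\,P_{n-2,n-2}^{(0,1,1)}$.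
   Formalization: In (2) and (3) the term in Q_{n-1,k} is dropped when k=n-1 (and the term in Q_{n-1,1} when n=2 in the k=1 recurrence), since the printed identities are false there: for n=2, k=1 in (2) the printed right side is 3x(1-x-2y)-2z, while the left side is 3x(1-x-2y). *)

theory Defs
  imports Complex_Main "HOL-Computational_Algebra.Polynomial"
begin

section \<open>Jacobi polynomials\<close>

text \<open>
  The classical formula
  \<open>P\<^sub>k(t) = (\<Sum>s\<le>k. (k + \<alpha> choose k - s) (k + \<beta> choose s) ((t - 1)/2)^s ((t + 1)/2)^(k - s))\<close>,
  which, unlike the hypergeometric one, needs no division by expressions in the parameters.
\<close>

definition jacobi :: "real \<Rightarrow> real \<Rightarrow> nat \<Rightarrow> real poly" where
  "jacobi \<alpha> \<beta> k =
     (\<Sum>s\<le>k. smult (((real k + \<alpha>) gchoose (k - s)) * ((real k + \<beta>) gchoose s))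
                ([:-1/2, 1/2:] ^ s * [:1/2, 1/2:] ^ (k - s)))"

definition jacobi_shift :: "real \<Rightarrow> real \<Rightarrow> nat \<Rightarrow> real poly" where
  "jacobi_shift \<alpha> \<beta> k = pcompose (jacobi \<alpha> \<beta> k) [:-1, 2:]"

lemma jacobi_normalization: "poly (jacobi \<alpha> \<beta> k) 1 = (real k + \<alpha>) gchoose k"
proof -
  have "poly (jacobi \<alpha> \<beta> k) 1
      = (\<Sum>s\<le>k. if s = 0 then (real k + \<alpha>) gchoose k else 0)"
    unfolding jacobi_def poly_sum by (intro sum.cong) (auto simp: power_0_left)
  then show ?thesis by simp
qed

lemma poly_jacobi_shift: "poly (jacobi_shift \<alpha> \<beta> k) x = poly (jacobi \<alpha> \<beta> k) (2 * x - 1)"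
  by (simp add: jacobi_shift_def poly_pcompose algebra_simps)

lemma degree_jacobi_shift_le: "degree (jacobi_shift \<alpha> \<beta> k) \<le> k"
proof -
  have "degree ([:-1/2, 1/2:] ^ s * [:1/2, 1/2 :: real:] ^ (k - s)) \<le> k" if "s \<le> k" for s
  proof -
    have "degree ([:-1/2, 1/2:] ^ s * [:1/2, 1/2 :: real:] ^ (k - s)) \<le> s + (k - s)"
      by (intro order.trans[OF degree_mult_le] add_mono order.trans[OF degree_power_le]) auto
    with that show ?thesis by simp
  qed
  then have "degree (jacobi \<alpha> \<beta> k) \<le> k"
    unfolding jacobi_def by (intro degree_sum_le order.trans[OF degree_smult_le]) auto
  then show ?thesis
    by (simp add: jacobi_shift_def degree_pcompose)
qed


section \<open>Polynomials in two variables\<close>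

text \<open>
  A polynomial in \<open>x, y\<close> is an element of \<open>\<real>[x][y]\<close>: the outer variable is \<open>y\<close>, the coefficients
  are polynomials in \<open>x\<close>. A polynomial \<open>p\<close> in \<open>x\<close> alone is thus \<open>[:p:]\<close>.
\<close>

definition X :: "real poly poly" where "X = [:[:0, 1:]:]"
definition Y :: "real poly poly" where "Y = [:0, 1:]"
definition Z :: "real poly poly" where "Z = 1 - X - Y"

definition eval2 :: "real poly poly \<Rightarrow> real \<Rightarrow> real \<Rightarrow> real" where
  "eval2 p x y = poly (poly p [:y:]) x"

lemma eval2_simps [simp]:
  "eval2 X x y = x" "eval2 Y x y = y" "eval2 Z x y = 1 - x - y"
  "eval2 [:p:] x y = poly p x" "eval2 0 x y = 0" "eval2 1 x y = 1"
  "eval2 (p' + q) x y = eval2 p' x y + eval2 q x y"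
  "eval2 (p' - q) x y = eval2 p' x y - eval2 q x y"
  "eval2 (- q) x y = - eval2 q x y"
  "eval2 (p' * q) x y = eval2 p' x y * eval2 q x y"
  "eval2 (p' ^ m) x y = eval2 p' x y ^ m"
  "eval2 (smult p q) x y = poly p x * eval2 q x y"
  "eval2 (of_nat m) x y = of_nat m"
  "eval2 (numeral w) x y = numeral w"
  by (simp_all add: eval2_def X_def Y_def Z_def of_nat_poly numeral_poly)

lemma eval2_sum: "eval2 (sum f A) x y = (\<Sum>i\<in>A. eval2 (f i) x y)"
  by (simp add: eval2_def poly_sum)


section \<open>Jacobi polynomials on the triangle\<close>

text \<open>
  The factor \<open>(1 - x)^k * jacobi_shift c b k (y / (1 - x))\<close> is a polynomial in \<open>x, y\<close>, namely the
  homogenization \<open>\<Sum>i\<le>k. c\<^sub>i y^i (1 - x)^(k - i)\<close>, where \<open>c\<^sub>i\<close> are the coefficients of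
  \<open>jacobi_shift c b k\<close>. Using it avoids the division, which in HOL would give wrong values on the
  line \<open>x = 1\<close>; lemma \<open>eval2_tri\<close> recovers the formula with the quotient off that line.
\<close>

definition tri :: "real \<Rightarrow> real \<Rightarrow> real \<Rightarrow> nat \<Rightarrow> nat \<Rightarrow> real poly poly" where
  "tri a b c n k =
     [:jacobi_shift (2 * real k + b + c + 1) a (n - k):] *
     (\<Sum>i\<le>k. [:[:coeff (jacobi_shift c b k) i:]:] * Y ^ i * (1 - X) ^ (k - i))"

lemma eval2_tri:
  assumes "x \<noteq> 1"
  shows "eval2 (tri a b c n k) x y =
           poly (jacobi_shift (2 * real k + b + c + 1) a (n - k)) x *
           (1 - x) ^ k * poly (jacobi_shift c b k) (y / (1 - x))"
proof -
  have *: "poly (jacobi_shift c b k) t = (\<Sum>i\<le>k. coeff (jacobi_shift c b k) i * t ^ i)" for t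
    by (subst poly_as_sum_of_monoms'[OF degree_jacobi_shift_le, symmetric])
       (simp add: poly_sum poly_monom)
  have "(\<Sum>i\<le>k. coeff (jacobi_shift c b k) i * y ^ i * (1 - x) ^ (k - i))
      = (1 - x) ^ k * poly (jacobi_shift c b k) (y / (1 - x))"
    unfolding * sum_distrib_left
    using assms by (intro sum.cong) (auto simp: power_diff power_divide field_simps)
  then show ?thesis
    by (simp add: tri_def eval2_sum mult.assoc)
qed


section \<open>Dirichlet bases\<close>

text \<open>In all four families only the indices \<open>k \<le> n\<close> are meaningful.\<close>

definition Q110 :: "nat \<Rightarrow> nat \<Rightarrow> real poly poly" where
  "Q110 n k =
     (if n = 0 then 1
      else if k = 0 then X * [:jacobi_shift 0 1 (n - 1):]
      else if k \<le> n - 1 then X * Y * tri 1 1 0 (n - 2) (k - 1)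
      else Y * tri 0 1 0 (n - 1) (n - 1))"

definition Q101 :: "nat \<Rightarrow> nat \<Rightarrow> real poly poly" where
  "Q101 n k =
     (if n = 0 then 1
      else if k = 0 then X * [:jacobi_shift 0 1 (n - 1):]
      else if k \<le> n - 1 then X * Z * tri 1 0 1 (n - 2) (k - 1)
      else Z * tri 0 0 1 (n - 1) (n - 1))"

definition Q011 :: "nat \<Rightarrow> nat \<Rightarrow> real poly poly" where
  "Q011 n k =
     (if n = 0 then 1
      else if k = 0 then (1 - X) * tri 0 0 0 (n - 1) 0
      else if k = 1 then (1 - X - 2 * Y) * tri 0 0 0 (n - 1) 0
      else Y * Z * tri 0 1 1 (n - 2) (k - 2))"

definition Q111 :: "nat \<Rightarrow> nat \<Rightarrow> real poly poly" where
  "Q111 n k =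
     (if n = 0 then 1
      else if n = 1 then (if k = 0 then 1 - 2 * X else 1 - X - 2 * Y)
      else if k = 0 then X * (1 - X) * tri 1 0 0 (n - 2) 0
      else if k = 1 then X * (1 - X - 2 * Y) * tri 1 0 0 (n - 2) 0
      else if k \<le> n - 1 then X * Y * Z * tri 1 1 1 (n - 3) (k - 2)
      else Y * Z * tri 0 1 1 (n - 2) (n - 2))"

lemma tri_0: "tri a b c n 0 = [:jacobi_shift (b + c + 1) a n:]"
  by (simp add: tri_def jacobi_shift_def jacobi_def one_pCons)

text \<open>
  The recurrences from \<open>Q111\<close> to \<open>Q101\<close> and \<open>Q110\<close> valid for \<open>1 \<le> k \<le> n - 2\<close> do not extend to
  \<open>k = n - 1\<close>: there their term in \<open>Q101 (n - 1) k\<close>, respectively \<open>Q110 (n - 1) k\<close>, has to be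
  dropped. With that term kept they fail already in the smallest cases.
\<close>

lemma boundary_term_fails:
  "3 * Q111 2 1 \<noteq> 6 * Q101 2 1 + Q101 2 0 - 2 * Q101 1 1 - Q101 1 0"
  "3 * Q111 2 1 \<noteq> - 6 * Q110 2 1 - Q110 2 0 + 2 * Q110 1 1 + Q110 1 0"
  "15 * Q111 3 2 \<noteq> 5 * Q101 3 2 - Q101 3 1 - Q101 2 2 + 3 * Q101 2 1"
  "15 * Q111 3 2 \<noteq> - 5 * Q110 3 2 - Q110 3 1 + Q110 2 2 + 3 * Q110 2 1"
proof -
  have ne: "p \<noteq> q" if "eval2 p x y \<noteq> eval2 q x y" for p q x y
    using that by auto
  note ev = Q111_def Q101_def Q110_def eval2_tri poly_jacobi_shift jacobi_def poly_sum
    gbinomial_prod_rev numeral_2_eq_2 numeral_3_eq_3 power2_eq_square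
  show "3 * Q111 2 1 \<noteq> 6 * Q101 2 1 + Q101 2 0 - 2 * Q101 1 1 - Q101 1 0"
    by (rule ne[of _ 0 0]) (simp add: ev)
  show "3 * Q111 2 1 \<noteq> - 6 * Q110 2 1 - Q110 2 0 + 2 * Q110 1 1 + Q110 1 0"
    by (rule ne[of _ 0 1]) (simp add: ev)
  show "15 * Q111 3 2 \<noteq> 5 * Q101 3 2 - Q101 3 1 - Q101 2 2 + 3 * Q101 2 1"
    by (rule ne[of _ 0 0]) (simp add: ev)
  show "15 * Q111 3 2 \<noteq> - 5 * Q110 3 2 - Q110 3 1 + Q110 2 2 + 3 * Q110 2 1"
    by (rule ne[of _ 0 1]) (simp add: ev)
qed

end

theory Submission
  imports Defs
begin

text \<open>
  In the coordinates \<open>x\<close> and \<open>t = y / (1 - x)\<close>, where \<open>z = (1 - t) (1 - x)\<close>, every \<open>Q\<close> is a product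
  of a function of \<open>x\<close> and a function of \<open>t\<close>. Each identity is then a combination of three contiguous
  relations for Jacobi polynomials, applied once in \<open>t\<close> (to remove the factor \<open>t\<close> or \<open>1 - t\<close>) and
  once in \<open>x\<close>. The contiguous relations follow by writing \<open>1 = x - (x - 1)\<close> to make them homogeneous
  in \<open>x - 1\<close> and \<open>x\<close>, and comparing coefficients.
\<close>

section \<open>Shifted Jacobi polynomials as binary forms in x - 1 and x\<close>

lemma poly_jacobi_shift_sum:
  "poly (jacobi_shift \<alpha> \<beta> m) x =
     (\<Sum>s\<le>m. ((real m + \<alpha>) gchoose (m - s)) * ((real m + \<beta>) gchoose s) * (x - 1) ^ s * x ^ (m - s))"
  unfolding poly_jacobi_shift jacobi_def poly_sum
proof (intro sum.cong refl)
  fix s assume "s \<in> {..m}"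
  have "poly [:-1 / 2, 1 / 2:] (2 * x - 1) = x - 1" "poly [:1 / 2, 1 / 2:] (2 * x - 1) = x"
    by (simp_all add: field_simps)
  then show "poly (smult (((real m + \<alpha>) gchoose (m - s)) * ((real m + \<beta>) gchoose s))
        ([:-1 / 2, 1 / 2:] ^ s * [:1 / 2, 1 / 2:] ^ (m - s))) (2 * x - 1) =
      ((real m + \<alpha>) gchoose (m - s)) * ((real m + \<beta>) gchoose s) * (x - 1) ^ s * x ^ (m - s)"
    by (simp only: poly_smult poly_mult poly_power mult.assoc)
qed

lemma jacobi_shift_0 [simp]: "jacobi_shift \<alpha> \<beta> 0 = 1"
  by (simp add: jacobi_shift_def jacobi_def one_pCons)

text \<open>Raises the degree of a binary form by one: a factor u shifts the coefficients, a factor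
  v in \<open>mult_right_binary_form\<close> keeps them. The \<open>if\<close> pads the missing end
  coefficient with 0, so that all sums run over the same index set.\<close>

lemma mult_left_binary_form:
  fixes u v :: "'a::comm_semiring_1"
  shows "u * (\<Sum>s\<le>m. c s * u ^ s * v ^ (m - s)) =
    (\<Sum>s\<le>Suc m. (if s = 0 then 0 else c (s - 1)) * u ^ s * v ^ (Suc m - s))"
  by (subst sum.atMost_Suc_shift) (simp add: sum_distrib_left mult_ac)

lemma mult_right_binary_form:
  fixes u v :: "'a::comm_semiring_1"
  shows "v * (\<Sum>s\<le>m. c s * u ^ s * v ^ (m - s)) =
    (\<Sum>s\<le>Suc m. (if s \<le> m then c s else 0) * u ^ s * v ^ (Suc m - s))"
  by (simp add: sum_distrib_left Suc_diff_le mult_ac)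

section \<open>Contiguous relations and the binomial identities behind them\<close>

lemma gbinomial_step: "(real s + 1) * (a gchoose Suc s) = (a - real s) * (a gchoose s)" for a :: real
  using gbinomial_mult_1[of a s] by (simp add: algebra_simps)

lemma gbinomial_lower: "(a + 1) * (a gchoose s) = (real s + 1) * ((a + 1) gchoose Suc s)" for a :: real
  using gbinomial_absorption[of s "a + 1"] by (simp add: algebra_simps)

text \<open>To be read with a0, a1 = A choose i, i + 1 and b0, b1 = B choose r, r + 1; by Pascal's
  rule a0 + a1 and b0 + b1 are then the coefficients with upper indices A + 1 and B + 1. The
  difference of the two sides is a linear combination of the assumptions.\<close>

lemma lower_left_coefficient:
  fixes A :: "'a::comm_ring_1"
  assumes "(A + 1) * a0 = (i + 1) * (a0 + a1)" "(r + 1) * b1 = (B - r) * b0"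
  shows "- (A + B + 2) * ((a0 + a1) * b0) =
    (A + 1) * (a0 * b1 - a1 * b0) - (r + i + 2) * ((a0 + a1) * (b0 + b1))"
proof -
  have "- (A + B + 2) * ((a0 + a1) * b0) -
      ((A + 1) * (a0 * b1 - a1 * b0) - (r + i + 2) * ((a0 + a1) * (b0 + b1))) =
      (a0 + a1) * ((r + 1) * b1 - (B - r) * b0) - (b0 + b1) * ((A + 1) * a0 - (i + 1) * (a0 + a1))"
    by (simp add: algebra_simps)
  then show ?thesis
    unfolding assms by simp
qed

text \<open>Same reading of a0, a1, b0, b1, with the two absorption identities interchanged between
  A and B.\<close>

lemma raise_left_coefficient:
  fixes A :: "'a::comm_ring_1"
  assumes "(i + 1) * a1 = (A - i) * a0" "(B + 1) * b0 = (r + 1) * (b0 + b1)"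
  shows "(A + B + 2) * (a1 * (b0 + b1)) =
    (A + B - (r + i + 1) + 1) * ((a0 + a1) * (b0 + b1)) - (B + 1) * (a0 * b1 - a1 * b0)"
proof -
  have "(A + B + 2) * (a1 * (b0 + b1)) -
      ((A + B - (r + i + 1) + 1) * ((a0 + a1) * (b0 + b1)) - (B + 1) * (a0 * b1 - a1 * b0)) =
      (b0 + b1) * ((i + 1) * a1 - (A - i) * a0) - (a0 + a1) * ((B + 1) * b0 - (r + 1) * (b0 + b1))"
    by (simp add: algebra_simps)
  then show ?thesis
    unfolding assms by simp
qed

text \<open>With u = x - 1 the factor 1 - x is -u, and the degree m polynomial on the right is
  multiplied by 1 = x - u. All terms are then forms of degree m + 1 in u and x, and equality of
  their coefficients suffices.\<close>

lemma jacobi_shift_lower_left: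
  "(2 * real m + \<alpha> + \<beta> + 2) * (1 - x) * poly (jacobi_shift (\<alpha> + 1) \<beta> m) x =
     (real m + \<alpha> + 1) * poly (jacobi_shift \<alpha> \<beta> m) x - (real m + 1) * poly (jacobi_shift \<alpha> \<beta> (Suc m)) x"
proof -
  define u where "u = x - 1"
  let ?S = "\<lambda>c k. \<Sum>s\<le>k. c s * u ^ s * x ^ (k - s)"
  let ?c = "\<lambda>s. ((real m + \<alpha>) gchoose (m - s)) * ((real m + \<beta>) gchoose s)"
  let ?d = "\<lambda>s. ((real m + (\<alpha> + 1)) gchoose (m - s)) * ((real m + \<beta>) gchoose s)"
  let ?e = "\<lambda>s. ((real (Suc m) + \<alpha>) gchoose (Suc m - s)) * ((real (Suc m) + \<beta>) gchoose s)"
  have coeff: "- (2 * real m + \<alpha> + \<beta> + 2) * (if s = 0 then 0 else ?d (s - 1)) =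
      (real m + \<alpha> + 1) * ((if s \<le> m then ?c s else 0) - (if s = 0 then 0 else ?c (s - 1)))
      - (real m + 1) * ?e s" if "s \<le> Suc m" for s
  \<comment> \<open>At the ends s = 0 and s = m + 1 only one of the two products from x - u
    contributes, and a single absorption identity is left. In between, m = r + i + 1 and both
    contribute.\<close>
  proof (cases s)
    case 0
    then show ?thesis
      using gbinomial_lower[of "real m + \<alpha>" m] by (simp add: algebra_simps)
  next
    case (Suc r)
    define A B where "A = real m + \<alpha>" and "B = real m + \<beta>"
    have shifts: "real (Suc m) + \<alpha> = A + 1" "real (Suc m) + \<beta> = B + 1" "real m + (\<alpha> + 1) = A + 1"
      "2 * real m + \<alpha> + \<beta> + 2 = A + B + 2" "real m + \<alpha> = A" "real m + \<beta> = B"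
      by (simp_all add: A_def B_def)
    show ?thesis
    proof (cases "r = m")
      case True
      show ?thesis
        using gbinomial_lower[of B m] unfolding Suc shifts True by (simp add: algebra_simps)
    next
      case False
      define i where "i = m - r - 1"
      have i: "m = r + i + 1"
        using False that Suc by (simp add: i_def)
      have diffs: "m - r = Suc i" "m - Suc r = i" "Suc m - Suc r = Suc i" "Suc r - 1 = r" "Suc r \<le> m"
        using i by simp_all
      have m: "real m + 1 = real r + real i + 2"
        using i by simp
      have "- (A + B + 2) * (((A + 1) gchoose Suc i) * (B gchoose r)) =
          (A + 1) * ((A gchoose i) * (B gchoose Suc r) - (A gchoose Suc i) * (B gchoose r))
          - (real r + real i + 2) * (((A + 1) gchoose Suc i) * ((B + 1) gchoose Suc r))"
        using gbinomial_lower[of A i] unfolding gbinomial_Suc_Suc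
        by (rule lower_left_coefficient[OF _ gbinomial_step])
      then show ?thesis
        unfolding Suc shifts diffs m by (simp add: diffs(5))
    qed
  qed
  have "(2 * real m + \<alpha> + \<beta> + 2) * (1 - x) * ?S ?d m = - (2 * real m + \<alpha> + \<beta> + 2) * (u * ?S ?d m)"
    by (simp add: u_def algebra_simps)
  also have "\<dots> = (real m + \<alpha> + 1) * (x * ?S ?c m - u * ?S ?c m) - (real m + 1) * ?S ?e (Suc m)"
    unfolding mult_left_binary_form mult_right_binary_form
    unfolding sum_distrib_left sum_subtractf [symmetric]
  proof (intro sum.cong refl, goal_cases)
    case (1 s)
    then show ?case
      using arg_cong[OF coeff[of s], of "\<lambda>r. r * (u ^ s * x ^ (Suc m - s))"]
      by (simp only: atMost_iff algebra_simps)
  qed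
  also have "x * ?S ?c m - u * ?S ?c m = ?S ?c m"
    by (simp add: u_def left_diff_distrib)
  finally show ?thesis
    by (simp only: poly_jacobi_shift_sum u_def)
qed

text \<open>The substitution sends x - 1 to -x and x to -(x - 1). Reversing the summation exchanges
  the two binomials, and the m linear factors give the sign.\<close>

lemma jacobi_shift_reflect:
  "poly (jacobi_shift \<alpha> \<beta> m) (1 - x) = (-1) ^ m * poly (jacobi_shift \<beta> \<alpha> m) x"
proof -
  let ?f = "\<lambda>s. ((real m + \<alpha>) gchoose (m - s)) * ((real m + \<beta>) gchoose s) * (- x) ^ s * (1 - x) ^ (m - s)"
  have "poly (jacobi_shift \<alpha> \<beta> m) (1 - x) = (\<Sum>s\<le>m. ?f s)"
    by (simp add: poly_jacobi_shift_sum)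
  also have "\<dots> = (\<Sum>s\<le>m. ?f (m - s))"
    using sum.atLeastAtMost_rev[of ?f 0 m] by (simp only: atMost_atLeast0 add_0_right)
  also have "\<dots> = (-1) ^ m * poly (jacobi_shift \<beta> \<alpha> m) x"
    unfolding poly_jacobi_shift_sum sum_distrib_left
  proof (intro sum.cong refl)
    fix s assume "s \<in> {..m}"
    then have s: "m - (m - s) = s" and m: "(-1) ^ m = (-1::real) ^ s * (-1) ^ (m - s)"
      by (simp_all flip: power_add)
    have "(1 - x) ^ s = (-1) ^ s * (x - 1) ^ s" "(- x) ^ (m - s) = (-1) ^ (m - s) * x ^ (m - s)"
      by (simp_all flip: power_mult_distrib)
    then show "?f (m - s) = (-1) ^ m *
        (((real m + \<beta>) gchoose (m - s)) * ((real m + \<alpha>) gchoose s) * (x - 1) ^ s * x ^ (m - s))"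
      unfolding s m by (simp only: mult_ac)
  qed
  finally show ?thesis .
qed

text \<open>Mirror image of \<open>jacobi_shift_lower_left\<close> under x -> 1 - x. Degrees m and m
  + 1 have opposite parity, which turns the minus into a plus.\<close>

lemma jacobi_shift_lower_right:
  "(2 * real m + \<alpha> + \<beta> + 2) * x * poly (jacobi_shift \<alpha> (\<beta> + 1) m) x =
     (real m + \<beta> + 1) * poly (jacobi_shift \<alpha> \<beta> m) x + (real m + 1) * poly (jacobi_shift \<alpha> \<beta> (Suc m)) x"
proof -
  have "(-1) ^ m * ((2 * real m + \<alpha> + \<beta> + 2) * x * poly (jacobi_shift \<alpha> (\<beta> + 1) m) x) =
      (-1) ^ m * ((real m + \<beta> + 1) * poly (jacobi_shift \<alpha> \<beta> m) x
        + (real m + 1) * poly (jacobi_shift \<alpha> \<beta> (Suc m)) x)"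
    using jacobi_shift_lower_left[of m \<beta> \<alpha> "1 - x"]
    by (simp add: jacobi_shift_reflect algebra_simps)
  then show ?thesis by simp
qed

text \<open>Stated in degree m + 1 because the right-hand side also involves degree m; only that
  last term has to be multiplied by 1 = x - u.\<close>

lemma jacobi_shift_raise_left:
  "(2 * real m + \<alpha> + \<beta> + 3) * poly (jacobi_shift \<alpha> \<beta> (Suc m)) x =
     (real m + \<alpha> + \<beta> + 2) * poly (jacobi_shift (\<alpha> + 1) \<beta> (Suc m)) x
     - (real m + \<beta> + 1) * poly (jacobi_shift (\<alpha> + 1) \<beta> m) x"
proof -
  define u where "u = x - 1"
  \<comment> \<open>With this choice all binomials below have upper index A, A + 1, B or B +
    1.\<close>
  define A B where "A = real m + \<alpha> + 1" and "B = real m + \<beta>"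
  let ?S = "\<lambda>c k. \<Sum>s\<le>k. c s * u ^ s * x ^ (k - s)"
  let ?c = "\<lambda>s. (A gchoose (m - s)) * (B gchoose s)"
  let ?d = "\<lambda>s. (A gchoose (Suc m - s)) * ((B + 1) gchoose s)"
  let ?e = "\<lambda>s. ((A + 1) gchoose (Suc m - s)) * ((B + 1) gchoose s)"
  have shifts: "real m + (\<alpha> + 1) = A" "real (Suc m) + (\<alpha> + 1) = A + 1" "real (Suc m) + \<alpha> = A"
    "real m + \<beta> = B" "real (Suc m) + \<beta> = B + 1"
    "2 * real m + \<alpha> + \<beta> + 3 = A + B + 2" "real m + \<alpha> + \<beta> + 2 = A + B - real m + 1"
    by (simp_all add: A_def B_def)
  have coeff: "(A + B + 2) * ?d s = (A + B - real m + 1) * ?e s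
      - (B + 1) * ((if s \<le> m then ?c s else 0) - (if s = 0 then 0 else ?c (s - 1)))"
    if "s \<le> Suc m" for s
  proof (cases s)
    case 0
    show ?thesis
      using gbinomial_Suc_Suc[of A m] gbinomial_step[of m A] unfolding 0 by (simp add: algebra_simps)
  next
    case (Suc r)
    show ?thesis
    proof (cases "r = m")
      case True
      show ?thesis
        using gbinomial_lower[of B m] unfolding Suc True by (simp add: algebra_simps)
    next
      case False
      define i where "i = m - r - 1"
      have i: "m = r + i + 1"
        using False that Suc by (simp add: i_def)
      have diffs: "m - r = Suc i" "m - Suc r = i" "Suc m - Suc r = Suc i" "Suc r - 1 = r" "Suc r \<le> m"
        using i by simp_all
      have m: "real m = real r + real i + 1"
        using i by simp
      have "(A + B + 2) * ((A gchoose Suc i) * ((B + 1) gchoose Suc r)) =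
          (A + B - (real r + real i + 1) + 1) * (((A + 1) gchoose Suc i) * ((B + 1) gchoose Suc r))
          - (B + 1) * ((A gchoose i) * (B gchoose Suc r) - (A gchoose Suc i) * (B gchoose r))"
        using gbinomial_lower[of B r] unfolding gbinomial_Suc_Suc
        by (rule raise_left_coefficient[OF gbinomial_step])
      then show ?thesis
        unfolding Suc diffs m by (simp add: diffs(5))
    qed
  qed
  have "(A + B + 2) * ?S ?d (Suc m) = (A + B - real m + 1) * ?S ?e (Suc m) - (B + 1) * (x * ?S ?c m - u * ?S ?c m)"
    unfolding mult_left_binary_form mult_right_binary_form
    unfolding sum_distrib_left sum_subtractf [symmetric]
  proof (intro sum.cong refl, goal_cases)
    case (1 s)
    then show ?case
      using arg_cong[OF coeff[of s], of "\<lambda>r. r * (u ^ s * x ^ (Suc m - s))"]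
      by (simp only: atMost_iff algebra_simps)
  qed
  also have "x * ?S ?c m - u * ?S ?c m = ?S ?c m"
    by (simp add: u_def left_diff_distrib)
  finally show ?thesis
    by (simp only: poly_jacobi_shift_sum shifts u_def)
qed

section \<open>Evaluation in the coordinates x and t\<close>

lemma eval2_eqI:
  assumes "\<And>x t. x \<noteq> 1 \<Longrightarrow> eval2 p x (t * (1 - x)) = eval2 q x (t * (1 - x))"
  shows "p = q"
proof -
  \<comment> \<open>Every point off the line x = 1 has the form (x, t (1 - x)). For fixed y this
    leaves infinitely many x.\<close>
  have ev: "eval2 p x y = eval2 q x y" if "x \<noteq> 1" for x y
    using assms[OF that, of "y / (1 - x)"] that by simp
  have poly_eq: "poly p [:y:] = poly q [:y:]" for y
  proof (rule ccontr)
    assume "poly p [:y:] \<noteq> poly q [:y:]"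
    then have "finite {x. poly (poly p [:y:] - poly q [:y:]) x = 0}"
      by (intro poly_roots_finite) simp
    moreover have "- {1} \<subseteq> {x. poly (poly p [:y:] - poly q [:y:]) x = 0}"
      using ev by (auto simp: eval2_def)
    moreover have "infinite (- {1 :: real})"
      by (simp add: finite_compl infinite_UNIV_char_0)
    ultimately show False
      using finite_subset by blast
  qed
  show "p = q"
  proof (rule ccontr)
    assume "p \<noteq> q"
    then have "finite {r. poly (p - q) r = 0}"
      by (intro poly_roots_finite) simp
    \<comment> \<open>Over the integral domain of polynomials in x, the constants
      \<open>[:y:]\<close> are infinitely many roots of \<open>p - q\<close>.\<close>
    moreover have "range (\<lambda>y. [:y:]) \<subseteq> {r. poly (p - q) r = 0}"
      using poly_eq by auto
    moreover have "infinite (range (\<lambda>y::real. [:y:]))"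
      by (simp add: finite_image_iff inj_def infinite_UNIV_char_0)
    ultimately show False
      using finite_subset by blast
  qed
qed

lemma eval2_tri_homogeneous:
  assumes "x \<noteq> 1"
  shows "eval2 (tri a b c n k) x (t * (1 - x)) =
    poly (jacobi_shift (2 * real k + b + c + 1) a (n - k)) x * (1 - x) ^ k * poly (jacobi_shift c b k) t"
  using eval2_tri[OF assms, of a b c n k "t * (1 - x)"] assms by simp

context
  fixes x t :: real
  assumes x: "x \<noteq> 1"
begin

lemma eval2_Q111_0:
  "n \<ge> 2 \<Longrightarrow> eval2 (Q111 n 0) x (t * (1 - x)) = x * (1 - x) * poly (jacobi_shift 1 1 (n - 2)) x"
  by (simp add: Q111_def tri_0)

lemma eval2_Q111_1:
  "n \<ge> 2 \<Longrightarrow> eval2 (Q111 n 1) x (t * (1 - x)) =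
     x * (1 - x) * (1 - 2 * t) * poly (jacobi_shift 1 1 (n - 2)) x"
  by (simp add: Q111_def tri_0 algebra_simps)

text \<open>Both y and z supply a factor 1 - x, which raises (1 - x)^(k - 2) to (1 - x)^k; the
  parameter in x is 2 (k - 2) + 3 = 2 k - 1.\<close>

lemma eval2_Q111_inner:
  assumes "2 \<le> k" "k < n"
  shows "eval2 (Q111 n k) x (t * (1 - x)) = x * (1 - x) ^ k * t * (1 - t) *
    poly (jacobi_shift (2 * real k - 1) 1 (n - k - 1)) x * poly (jacobi_shift 1 1 (k - 2)) t"
proof -
  obtain j where k: "k = Suc (Suc j)"
    using assms(1) by (metis Suc_le_D numeral_2_eq_2 Suc_le_mono)
  have "1 - x - t * (1 - x) = (1 - x) * (1 - t)" "2 * real j + 1 + 1 + 1 = 2 * real k - 1" "n - 3 - j = n - k - 1"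
    using k assms by (simp_all add: algebra_simps)
  then show ?thesis
    using assms by (simp add: Q111_def eval2_tri_homogeneous[OF x] k mult_ac)
qed

lemma eval2_Q111_diag:
  assumes "n \<ge> 2"
  shows "eval2 (Q111 n n) x (t * (1 - x)) = (1 - x) ^ n * t * (1 - t) * poly (jacobi_shift 1 1 (n - 2)) t"
proof -
  obtain j where n: "n = Suc (Suc j)"
    using assms(1) by (metis Suc_le_D numeral_2_eq_2 Suc_le_mono)
  have "1 - x - t * (1 - x) = (1 - x) * (1 - t)"
    by (simp add: algebra_simps)
  then show ?thesis
    by (simp add: Q111_def eval2_tri_homogeneous[OF x] n mult_ac)
qed

lemma eval2_Q011_0:
  "n \<ge> 1 \<Longrightarrow> eval2 (Q011 n 0) x (t * (1 - x)) = (1 - x) * poly (jacobi_shift 1 0 (n - 1)) x"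
  by (simp add: Q011_def tri_0)

lemma eval2_Q011_1:
  "n \<ge> 1 \<Longrightarrow> eval2 (Q011 n 1) x (t * (1 - x)) =
     (1 - x) * (1 - 2 * t) * poly (jacobi_shift 1 0 (n - 1)) x"
  by (simp add: Q011_def tri_0 algebra_simps)

text \<open>Unlike the other three families, \<open>Q011\<close> has no separate diagonal formula,
  so k = n is included.\<close>

lemma eval2_Q011_inner:
  assumes "2 \<le> k" "k \<le> n"
  shows "eval2 (Q011 n k) x (t * (1 - x)) = (1 - x) ^ k * t * (1 - t) *
    poly (jacobi_shift (2 * real k - 1) 0 (n - k)) x * poly (jacobi_shift 1 1 (k - 2)) t"
proof -
  obtain j where k: "k = Suc (Suc j)"
    using assms(1) by (metis Suc_le_D numeral_2_eq_2 Suc_le_mono)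
  have "1 - x - t * (1 - x) = (1 - x) * (1 - t)" "2 * real j + 1 + 1 + 1 = 2 * real k - 1" "n - 2 - j = n - k"
    using k assms by (simp_all add: algebra_simps)
  then show ?thesis
    using assms by (simp add: Q011_def eval2_tri_homogeneous[OF x] k mult_ac)
qed

lemma eval2_Q101_0:
  "n \<ge> 1 \<Longrightarrow> eval2 (Q101 n 0) x (t * (1 - x)) = x * poly (jacobi_shift 0 1 (n - 1)) x"
  by (simp add: Q101_def)

text \<open>Only z supplies a factor 1 - x here, as only y does for \<open>Q110\<close>, so the
  parameter in x is 2 (k - 1) + 2 = 2 k. The two bases share their factor in x and differ only in
  t.\<close>

lemma eval2_Q101_inner:
  assumes "1 \<le> k" "k < n"
  shows "eval2 (Q101 n k) x (t * (1 - x)) = x * (1 - x) ^ k * (1 - t) *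
    poly (jacobi_shift (2 * real k) 1 (n - k - 1)) x * poly (jacobi_shift 1 0 (k - 1)) t"
proof -
  obtain j where k: "k = Suc j"
    using assms(1) by (cases k) auto
  have "1 - x - t * (1 - x) = (1 - x) * (1 - t)" "2 * real j + 0 + 1 + 1 = 2 * real k" "n - 2 - j = n - k - 1"
    using k assms by (simp_all add: algebra_simps)
  then show ?thesis
    using assms by (simp add: Q101_def eval2_tri_homogeneous[OF x] k mult_ac)
qed

lemma eval2_Q101_diag:
  assumes "n \<ge> 1"
  shows "eval2 (Q101 n n) x (t * (1 - x)) = (1 - x) ^ n * (1 - t) * poly (jacobi_shift 1 0 (n - 1)) t"
proof -
  obtain j where n: "n = Suc j"
    using assms(1) by (cases n) auto
  have "1 - x - t * (1 - x) = (1 - x) * (1 - t)"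
    by (simp add: algebra_simps)
  then show ?thesis
    by (simp add: Q101_def eval2_tri_homogeneous[OF x] n mult_ac)
qed

lemma eval2_Q110_0:
  "n \<ge> 1 \<Longrightarrow> eval2 (Q110 n 0) x (t * (1 - x)) = x * poly (jacobi_shift 0 1 (n - 1)) x"
  by (simp add: Q110_def)

lemma eval2_Q110_inner:
  assumes "1 \<le> k" "k < n"
  shows "eval2 (Q110 n k) x (t * (1 - x)) = x * (1 - x) ^ k * t *
    poly (jacobi_shift (2 * real k) 1 (n - k - 1)) x * poly (jacobi_shift 0 1 (k - 1)) t"
proof -
  obtain j where k: "k = Suc j"
    using assms(1) by (cases k) auto
  have "2 * real j + 1 + 0 + 1 = 2 * real k" "n - 2 - j = n - k - 1"
    using k assms by (simp_all add: algebra_simps)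
  then show ?thesis
    using assms by (simp add: Q110_def eval2_tri_homogeneous[OF x] k mult_ac)
qed

lemma eval2_Q110_diag:
  assumes "n \<ge> 1"
  shows "eval2 (Q110 n n) x (t * (1 - x)) = (1 - x) ^ n * t * poly (jacobi_shift 0 1 (n - 1)) t"
proof -
  obtain j where n: "n = Suc j"
    using assms(1) by (cases n) auto
  show ?thesis
    by (simp add: Q110_def eval2_tri_homogeneous[OF x] n mult_ac)
qed

end

section \<open>Contiguous relations at the parameters of the bases\<close>

lemma jacobi_shift_raise_alpha:
  assumes "1 \<le> k" "k < n"
  shows "(2 * real n - 1) * poly (jacobi_shift (2 * real k - 1) 1 (n - k - 1)) x =
    (real n + real k) * poly (jacobi_shift (2 * real k) 1 (n - k - 1)) x
    - (if k = n - 1 then 0 else (real n - real k) * poly (jacobi_shift (2 * real k) 1 (n - 1 - k - 1)) x)"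
proof (cases "k = n - 1")
  \<comment> \<open>Both polynomials have degree 0 and 2 n - 1 = n + k. Truncated subtraction would
    read the dropped term as (n - k) * 1 and falsify the equation; every \<open>if\<close> in the
    final identities stems from here.\<close>
  case True
  then have n: "n = Suc k"
    using assms by simp
  show ?thesis
    unfolding n by simp
next
  case False
  define m where "m = n - k - 2"
  have n: "n = k + m + 2"
    using assms False by (simp add: m_def)
  have "n - k - 1 = Suc m" "n - 1 - k - 1 = m"
    "2 * real m + (2 * real k - 1) + 1 + 3 = 2 * real n - 1" "2 * real k - 1 + 1 = 2 * real k"
    "real m + (2 * real k - 1) + 1 + 2 = real n + real k" "real m + 1 + 1 = real n - real k"
    using n by simp_all
  then show ?thesis
    using jacobi_shift_raise_left[of m "2 * real k - 1" 1 x] unfolding if_not_P[OF False] by (simp only:)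
qed

text \<open>From alpha = 2 k - 1, raising leads to 2 k, the parameter of two-edge elements of index
  k, while lowering at the cost of 1 - x leads to \<open>2 * real (k - 1)\<close>, the one for index
  k - 1.\<close>

lemma jacobi_shift_lower_alpha:
  assumes "1 \<le> k" "k < n"
  shows "(2 * real n - 1) * (1 - x) * poly (jacobi_shift (2 * real k - 1) 1 (n - k - 1)) x =
    (real n + real k - 2) * poly (jacobi_shift (2 * real (k - 1)) 1 (n - k - 1)) x
    - (real n - real k) * poly (jacobi_shift (2 * real (k - 1)) 1 (n - k)) x"
proof -
  obtain m where n: "n = k + m + 1"
    using assms(2) by (metis less_natE add_Suc_right Suc_eq_plus1)
  have "n - k - 1 = m" "n - k = Suc m" "2 * real m + 2 * real (k - 1) + 1 + 2 = 2 * real n - 1"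
    "2 * real (k - 1) + 1 = 2 * real k - 1" "real m + 2 * real (k - 1) + 1 = real n + real k - 2"
    "real m + 1 = real n - real k"
    using n assms by (simp_all add: of_nat_diff)
  then show ?thesis
    using jacobi_shift_lower_left[of m "2 * real (k - 1)" 1 x] by (simp only:)
qed

lemma jacobi_shift_lower_beta:
  assumes "1 \<le> k" "k < n"
  shows "(2 * real n - 1) * x * poly (jacobi_shift (2 * real k - 1) 1 (n - k - 1)) x =
    (real n - real k) * (poly (jacobi_shift (2 * real k - 1) 0 (n - k)) x
      + poly (jacobi_shift (2 * real k - 1) 0 (n - 1 - k)) x)"
proof -
  obtain m where n: "n = k + m + 1"
    using assms(2) by (metis less_natE add_Suc_right Suc_eq_plus1)
  have "n - k - 1 = m" "n - 1 - k = m" "n - k = Suc m" "2 * real m + (2 * real k - 1) + 0 + 2 = 2 * real n - 1"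
    "real m + 0 + 1 = real n - real k" "real m + 1 = real n - real k" "0 + 1 = (1::real)"
    using n assms by simp_all
  then show ?thesis
    using jacobi_shift_lower_right[of m "2 * real k - 1" 0 x]
    by (simp only:) (simp only: distrib_left add.commute)
qed

text \<open>The relations in t are those in x at index 1, where 2 * 1 - 1 = 1 makes both parameters
  equal to 1, with k in the role of n.\<close>

lemma jacobi_shift_1_1_times_t:
  assumes "k \<ge> 2"
  shows "(2 * real k - 1) * t * poly (jacobi_shift 1 1 (k - 2)) t =
    (real k - 1) * (poly (jacobi_shift 1 0 (k - 1)) t + poly (jacobi_shift 1 0 (k - 1 - 1)) t)"
  using jacobi_shift_lower_beta[of 1 k t] assms by (simp add: numeral_2_eq_2 add.commute)

lemma jacobi_shift_1_1_times_one_minus_t: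
  assumes "k \<ge> 2"
  shows "(2 * real k - 1) * (1 - t) * poly (jacobi_shift 1 1 (k - 2)) t =
    (real k - 1) * (poly (jacobi_shift 0 1 (k - 1 - 1)) t - poly (jacobi_shift 0 1 (k - 1)) t)"
  using jacobi_shift_lower_alpha[of 1 k t] assms by (simp add: numeral_2_eq_2 algebra_simps)

text \<open>Here y is 1 - x, w is (1 - x)^(k - 1), C the Jacobi factor in t and J the one in x. The
  relation in t yields p of index k and q of index k - 1. The term with p keeps (1 - x)^k and
  expands J by B; the term with q has a factor 1 - x to spare, which is absorbed by expanding y * J
  by A.\<close>

lemma combine_relations:
  fixes x :: "'a::comm_ring_1"
  assumes "a * s * C = c * (p + q)" "N * y * J = A" "N * J = B"
  shows "N * a * (x * (w * y) * s * s' * J * C) = x * w * s' * c * (y * p * B + q * A)"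
proof -
  have "N * a * (x * (w * y) * s * s' * J * C) = x * w * s' * (a * s * C) * (N * y * J)"
    by (simp only: mult_ac)
  also have "\<dots> = x * w * s' * c * (y * p * (N * J) + q * (N * y * J))"
    unfolding assms(1) by (simp add: algebra_simps)
  finally show ?thesis
    unfolding assms(2,3) .
qed

section \<open>From (1,1,1) to (0,1,1)\<close>

lemma Q111_0_Q011:
  assumes "n \<ge> 2"
  shows "(2 * of_nat n - 1) * Q111 n 0 = (of_nat n - 1) * (Q011 n 0 + Q011 (n - 1) 0)"
proof (rule eval2_eqI)
  fix x t :: real
  assume x: "x \<noteq> 1"
  have n: "n - 1 \<ge> 1" "n - 1 - 1 = n - 2" "n \<ge> 1" using assms by simp_all
  \<comment> \<open>For k = 0 and k = 1 the Jacobi factor in x has both parameters 1, so the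
    relation for t is applied at x.\<close>
  have rel: "(2 * real n - 1) * x * poly (jacobi_shift 1 1 (n - 2)) x =
      (real n - 1) * (poly (jacobi_shift 1 0 (n - 1)) x + poly (jacobi_shift 1 0 (n - 2)) x)"
    using jacobi_shift_1_1_times_t[of n x] assms by (simp add: numeral_2_eq_2)
  show "eval2 ((2 * of_nat n - 1) * Q111 n 0) x (t * (1 - x)) =
      eval2 ((of_nat n - 1) * (Q011 n 0 + Q011 (n - 1) 0)) x (t * (1 - x))"
    using arg_cong[OF rel, of "\<lambda>r. (1 - x) * r"]
    unfolding eval2_simps eval2_Q111_0[OF x assms]
    by (simp only: eval2_Q011_0[OF x] n) (simp add: algebra_simps)
qed

lemma Q111_1_Q011:
  assumes "n \<ge> 2"
  shows "(2 * of_nat n - 1) * Q111 n 1 = (of_nat n - 1) * (Q011 n 1 + Q011 (n - 1) 1)"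
proof (rule eval2_eqI)
  fix x t :: real
  assume x: "x \<noteq> 1"
  have n: "n - 1 \<ge> 1" "n - 1 - 1 = n - 2" "n \<ge> 1" using assms by simp_all
  have rel: "(2 * real n - 1) * x * poly (jacobi_shift 1 1 (n - 2)) x =
      (real n - 1) * (poly (jacobi_shift 1 0 (n - 1)) x + poly (jacobi_shift 1 0 (n - 2)) x)"
    using jacobi_shift_1_1_times_t[of n x] assms by (simp add: numeral_2_eq_2)
  show "eval2 ((2 * of_nat n - 1) * Q111 n 1) x (t * (1 - x)) =
      eval2 ((of_nat n - 1) * (Q011 n 1 + Q011 (n - 1) 1)) x (t * (1 - x))"
    using arg_cong[OF rel, of "\<lambda>r. (1 - x) * (1 - 2 * t) * r"]
    unfolding eval2_simps eval2_Q111_1[OF x assms]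
    by (simp only: eval2_Q011_1[OF x] n) (simp add: algebra_simps)
qed

text \<open>The factors in t agree on both sides, so a single relation in x, lowering beta from 1 to
  0, is enough.\<close>

lemma Q111_inner_Q011:
  assumes "2 \<le> k" "k < n"
  shows "(2 * of_nat n - 1) * Q111 n k = (of_nat n - of_nat k) * (Q011 n k + Q011 (n - 1) k)"
proof (rule eval2_eqI)
  fix x t :: real
  assume x: "x \<noteq> 1"
  have k: "k \<le> n" "k \<le> n - 1" "1 \<le> k" using assms by simp_all
  show "eval2 ((2 * of_nat n - 1) * Q111 n k) x (t * (1 - x)) =
      eval2 ((of_nat n - of_nat k) * (Q011 n k + Q011 (n - 1) k)) x (t * (1 - x))"
    using arg_cong[OF jacobi_shift_lower_beta[OF k(3) assms(2), of x],
        of "\<lambda>r. (1 - x) ^ k * t * (1 - t) * poly (jacobi_shift 1 1 (k - 2)) t * r"]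
    unfolding eval2_simps eval2_Q111_inner[OF x assms]
    by (simp only: eval2_Q011_inner[OF x assms(1)] k) (simp add: algebra_simps)
qed

lemma Q111_diag_Q011:
  assumes "n \<ge> 2"
  shows "Q111 n n = Q011 n n"
  using assms by (auto simp: Q111_def Q011_def)

section \<open>From (1,1,1) to (1,0,1)\<close>

lemma Q111_0_Q101:
  assumes "n \<ge> 2"
  shows "(2 * of_nat n - 1) * Q111 n 0 = (of_nat n - 1) * (- Q101 n 0 + Q101 (n - 1) 0)"
proof (rule eval2_eqI)
  fix x t :: real
  assume x: "x \<noteq> 1"
  have "n - 1 \<ge> 1" "n \<ge> 1" using assms by simp_all
  then show "eval2 ((2 * of_nat n - 1) * Q111 n 0) x (t * (1 - x)) =
      eval2 ((of_nat n - 1) * (- Q101 n 0 + Q101 (n - 1) 0)) x (t * (1 - x))"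
    using arg_cong[OF jacobi_shift_1_1_times_one_minus_t[OF assms, of x], of "\<lambda>r. x * r"]
    unfolding eval2_simps eval2_Q111_0[OF x assms] by (simp only: eval2_Q101_0[OF x]) (simp add: algebra_simps)
qed

lemma Q111_1_Q101:
  assumes "n \<ge> 2"
  shows "(2 * of_nat n - 1) * Q111 n 1 =
    2 * (of_nat n + 1) * Q101 n 1 + (of_nat n - 1) * Q101 n 0
    - (if n = 2 then 0 else 2 * (of_nat n - 1) * Q101 (n - 1) 1)
    - (of_nat n - 1) * Q101 (n - 1) 0"
proof (rule eval2_eqI)
  fix x t :: real
  assume x: "x \<noteq> 1"
  have n: "n - 1 \<ge> 1" "n \<ge> 1" "1 < n" "n - 1 - 1 = n - 2" "(1::nat) \<le> 1" "1 < n - 1 \<longleftrightarrow> n \<noteq> 2"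
    using assms by auto
  have alpha: "(2 * real n - 1) * poly (jacobi_shift 1 1 (n - 2)) x =
      (real n + 1) * poly (jacobi_shift 2 1 (n - 2)) x
      - (if n = 2 then 0 else (real n - 1) * poly (jacobi_shift 2 1 (n - 1 - 2)) x)"
    using jacobi_shift_raise_alpha[of 1 n x] assms by (auto simp: numeral_2_eq_2)
  have Q: "eval2 (Q101 m 1) x (t * (1 - x)) = x * (1 - x) * (1 - t) * poly (jacobi_shift 2 1 (m - 2)) x"
    if "1 < m" for m
    using eval2_Q101_inner[OF x, of 1 m t] that by (simp add: numeral_2_eq_2)
  note rel = jacobi_shift_1_1_times_one_minus_t[OF assms, of x]
  \<comment> \<open>Uses 1 - 2 t = 2 (1 - t) - 1: the first part is expanded by raising alpha into
    elements of index 1, the second absorbs its factor 1 - x and gives elements of index 0.\<close>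
  have lhs: "eval2 ((2 * of_nat n - 1) * Q111 n 1) x (t * (1 - x)) =
      2 * x * (1 - x) * (1 - t) * ((2 * real n - 1) * poly (jacobi_shift 1 1 (n - 2)) x)
      - x * ((2 * real n - 1) * (1 - x) * poly (jacobi_shift 1 1 (n - 2)) x)"
    unfolding eval2_simps eval2_Q111_1[OF x assms] by (simp add: algebra_simps)
  show "eval2 ((2 * of_nat n - 1) * Q111 n 1) x (t * (1 - x)) =
      eval2 (2 * (of_nat n + 1) * Q101 n 1 + (of_nat n - 1) * Q101 n 0
        - (if n = 2 then 0 else 2 * (of_nat n - 1) * Q101 (n - 1) 1)
        - (of_nat n - 1) * Q101 (n - 1) 0) x (t * (1 - x))"
  proof (cases "n = 2")
    case True
    show ?thesis
      unfolding lhs alpha rel if_P[OF True] unfolding eval2_simps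
      by (simp only: eval2_Q101_0[OF x] Q n) (simp add: algebra_simps)
  next
    case False
    show ?thesis
      unfolding lhs alpha rel if_not_P[OF False] unfolding eval2_simps
      by (simp only: eval2_Q101_0[OF x] Q n False not_False_eq_True) (simp add: algebra_simps)
  qed
qed

text \<open>Two terms from removing t, each split in two by a relation in x, give the four elements.
  For k = n - 1 the element \<open>Q101 (n - 1) k\<close> would be diagonal, without the factor x,
  and its term is absent.\<close>

lemma Q111_inner_Q101:
  assumes "2 \<le> k" "k < n"
  shows "(2 * of_nat n - 1) * (2 * of_nat k - 1) * Q111 n k =
    (of_nat n + of_nat k) * (of_nat k - 1) * Q101 n k
    - (of_nat n - of_nat k) * (of_nat k - 1) * Q101 n (k - 1)
    - (if k = n - 1 then 0 else (of_nat n - of_nat k) * (of_nat k - 1) * Q101 (n - 1) k)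
    + (of_nat n + of_nat k - 2) * (of_nat k - 1) * Q101 (n - 1) (k - 1)"
proof (rule eval2_eqI)
  fix x t :: real
  assume x: "x \<noteq> 1"
  have k: "1 \<le> k" "1 \<le> k - 1" "k - 1 < n" "k - 1 < n - 1" "k < n - 1 \<longleftrightarrow> k \<noteq> n - 1"
    "n - (k - 1) - 1 = n - k" "n - 1 - (k - 1) - 1 = n - k - 1" "(1 - x) ^ k = (1 - x) ^ (k - 1) * (1 - x)"
    using assms by (auto simp flip: power_Suc2)
  have rel_t: "(2 * real k - 1) * t * poly (jacobi_shift 1 1 (k - 2)) t =
      (real k - 1) * (poly (jacobi_shift 1 0 (k - 1)) t + poly (jacobi_shift 1 0 (k - 1 - 1)) t)"
    using jacobi_shift_1_1_times_t[OF assms(1), of t] by simp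
  note key = combine_relations[OF rel_t jacobi_shift_lower_alpha[OF k(1) assms(2), of x]
      jacobi_shift_raise_alpha[OF k(1) assms(2), of x], of x "(1 - x) ^ (k - 1)" "1 - t"]
  have lhs: "eval2 ((2 * of_nat n - 1) * (2 * of_nat k - 1) * Q111 n k) x (t * (1 - x)) =
      (2 * real n - 1) * (2 * real k - 1) * (x * ((1 - x) ^ (k - 1) * (1 - x)) * t * (1 - t) *
        poly (jacobi_shift (2 * real k - 1) 1 (n - k - 1)) x * poly (jacobi_shift 1 1 (k - 2)) t)"
    unfolding eval2_simps eval2_Q111_inner[OF x assms] k(8) by (simp only: mult_ac of_nat_numeral)
  show "eval2 ((2 * of_nat n - 1) * (2 * of_nat k - 1) * Q111 n k) x (t * (1 - x)) =
      eval2 ((of_nat n + of_nat k) * (of_nat k - 1) * Q101 n k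
        - (of_nat n - of_nat k) * (of_nat k - 1) * Q101 n (k - 1)
        - (if k = n - 1 then 0 else (of_nat n - of_nat k) * (of_nat k - 1) * Q101 (n - 1) k)
        + (of_nat n + of_nat k - 2) * (of_nat k - 1) * Q101 (n - 1) (k - 1)) x (t * (1 - x))"
  proof (cases "k = n - 1")
    case True
    show ?thesis
      unfolding lhs key if_P[OF True] unfolding eval2_simps
      by (simp only: eval2_Q101_inner[OF x] k assms) algebra
  next
    case False
    show ?thesis
      unfolding lhs key if_not_P[OF False] unfolding eval2_simps
      by (simp only: eval2_Q101_inner[OF x] k assms False not_False_eq_True) algebra
  qed
qed

text \<open>No relation in x enters. The term of lower degree in t carries (1 - x)^(n - 1) (1 - x);
  splitting the last factor into 1 and -x gives \<open>Q101 (n - 1) (n - 1)\<close> and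
  \<open>- Q101 n (n - 1)\<close>.\<close>

lemma Q111_diag_Q101:
  assumes "n \<ge> 2"
  shows "(2 * of_nat n - 1) * Q111 n n =
    (of_nat n - 1) * (Q101 n n - Q101 n (n - 1) + Q101 (n - 1) (n - 1))"
proof (rule eval2_eqI)
  fix x t :: real
  assume x: "x \<noteq> 1"
  have n: "n \<ge> 1" "n - 1 \<ge> 1" "n - 1 < n" "n - (n - 1) - 1 = 0" "(1 - x) ^ n = (1 - x) ^ (n - 1) * (1 - x)"
    using assms by (auto simp flip: power_Suc2)
  show "eval2 ((2 * of_nat n - 1) * Q111 n n) x (t * (1 - x)) =
      eval2 ((of_nat n - 1) * (Q101 n n - Q101 n (n - 1) + Q101 (n - 1) (n - 1))) x (t * (1 - x))"
    using arg_cong[OF jacobi_shift_1_1_times_t[OF assms, of t],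
        of "\<lambda>r. (1 - x) ^ (n - 1) * (1 - x) * (1 - t) * r"]
    unfolding eval2_simps eval2_Q111_diag[OF x assms]
    by (simp only: eval2_Q101_inner[OF x] eval2_Q101_diag[OF x] n jacobi_shift_0 poly_1) (simp add: algebra_simps)
qed

section \<open>From (1,1,1) to (1,1,0), with t and 1 - t exchanged\<close>

lemma Q111_0_Q110:
  assumes "n \<ge> 2"
  shows "(2 * of_nat n - 1) * Q111 n 0 = (of_nat n - 1) * (- Q110 n 0 + Q110 (n - 1) 0)"
proof (rule eval2_eqI)
  fix x t :: real
  assume x: "x \<noteq> 1"
  have "n - 1 \<ge> 1" "n \<ge> 1" using assms by simp_all
  then show "eval2 ((2 * of_nat n - 1) * Q111 n 0) x (t * (1 - x)) =
      eval2 ((of_nat n - 1) * (- Q110 n 0 + Q110 (n - 1) 0)) x (t * (1 - x))"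
    using arg_cong[OF jacobi_shift_1_1_times_one_minus_t[OF assms, of x], of "\<lambda>r. x * r"]
    unfolding eval2_simps eval2_Q111_0[OF x assms] by (simp only: eval2_Q110_0[OF x]) (simp add: algebra_simps)
qed

lemma Q111_1_Q110:
  assumes "n \<ge> 2"
  shows "(2 * of_nat n - 1) * Q111 n 1 =
    - 2 * (of_nat n + 1) * Q110 n 1 - (of_nat n - 1) * Q110 n 0
    + (if n = 2 then 0 else 2 * (of_nat n - 1) * Q110 (n - 1) 1)
    + (of_nat n - 1) * Q110 (n - 1) 0"
proof (rule eval2_eqI)
  fix x t :: real
  assume x: "x \<noteq> 1"
  have n: "n - 1 \<ge> 1" "n \<ge> 1" "1 < n" "n - 1 - 1 = n - 2" "(1::nat) \<le> 1" "1 < n - 1 \<longleftrightarrow> n \<noteq> 2"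
    using assms by auto
  have alpha: "(2 * real n - 1) * poly (jacobi_shift 1 1 (n - 2)) x =
      (real n + 1) * poly (jacobi_shift 2 1 (n - 2)) x
      - (if n = 2 then 0 else (real n - 1) * poly (jacobi_shift 2 1 (n - 1 - 2)) x)"
    using jacobi_shift_raise_alpha[of 1 n x] assms by (auto simp: numeral_2_eq_2)
  have Q: "eval2 (Q110 m 1) x (t * (1 - x)) = x * (1 - x) * t * poly (jacobi_shift 2 1 (m - 2)) x"
    if "1 < m" for m
    using eval2_Q110_inner[OF x, of 1 m t] that by (simp add: numeral_2_eq_2)
  note rel = jacobi_shift_1_1_times_one_minus_t[OF assms, of x]
  \<comment> \<open>Now 1 - 2 t is already split as needed: 1 belongs to index 0 and -2 t to index
    1.\<close>
  have lhs: "eval2 ((2 * of_nat n - 1) * Q111 n 1) x (t * (1 - x)) =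
      x * ((2 * real n - 1) * (1 - x) * poly (jacobi_shift 1 1 (n - 2)) x)
      - 2 * x * (1 - x) * t * ((2 * real n - 1) * poly (jacobi_shift 1 1 (n - 2)) x)"
    unfolding eval2_simps eval2_Q111_1[OF x assms] by (simp add: algebra_simps)
  show "eval2 ((2 * of_nat n - 1) * Q111 n 1) x (t * (1 - x)) =
      eval2 (- 2 * (of_nat n + 1) * Q110 n 1 - (of_nat n - 1) * Q110 n 0
        + (if n = 2 then 0 else 2 * (of_nat n - 1) * Q110 (n - 1) 1)
        + (of_nat n - 1) * Q110 (n - 1) 0) x (t * (1 - x))"
  proof (cases "n = 2")
    case True
    show ?thesis
      unfolding lhs alpha rel if_P[OF True] unfolding eval2_simps
      by (simp only: eval2_Q110_0[OF x] Q n) (simp add: algebra_simps)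
  next
    case False
    show ?thesis
      unfolding lhs alpha rel if_not_P[OF False] unfolding eval2_simps
      by (simp only: eval2_Q110_0[OF x] Q n False not_False_eq_True) (simp add: algebra_simps)
  qed
qed

lemma Q111_inner_Q110:
  assumes "2 \<le> k" "k < n"
  shows "(2 * of_nat n - 1) * (2 * of_nat k - 1) * Q111 n k =
    - ((of_nat n + of_nat k) * (of_nat k - 1) * Q110 n k)
    - (of_nat n - of_nat k) * (of_nat k - 1) * Q110 n (k - 1)
    + (if k = n - 1 then 0 else (of_nat n - of_nat k) * (of_nat k - 1) * Q110 (n - 1) k)
    + (of_nat n + of_nat k - 2) * (of_nat k - 1) * Q110 (n - 1) (k - 1)"
proof (rule eval2_eqI)
  fix x t :: real
  assume x: "x \<noteq> 1"
  have k: "1 \<le> k" "1 \<le> k - 1" "k - 1 < n" "k - 1 < n - 1" "k < n - 1 \<longleftrightarrow> k \<noteq> n - 1"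
    "n - (k - 1) - 1 = n - k" "n - 1 - (k - 1) - 1 = n - k - 1" "(1 - x) ^ k = (1 - x) ^ (k - 1) * (1 - x)"
    using assms by (auto simp flip: power_Suc2)
  \<comment> \<open>The minus sign is attached to the term of index k, to fit the sum p + q in
    \<open>combine_relations\<close>.\<close>
  have rel_t: "(2 * real k - 1) * (1 - t) * poly (jacobi_shift 1 1 (k - 2)) t =
      (real k - 1) * (- poly (jacobi_shift 0 1 (k - 1)) t + poly (jacobi_shift 0 1 (k - 1 - 1)) t)"
    using jacobi_shift_1_1_times_one_minus_t[OF assms(1), of t] by simp
  note key = combine_relations[OF rel_t jacobi_shift_lower_alpha[OF k(1) assms(2), of x]
      jacobi_shift_raise_alpha[OF k(1) assms(2), of x], of x "(1 - x) ^ (k - 1)" "t"]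
  have lhs: "eval2 ((2 * of_nat n - 1) * (2 * of_nat k - 1) * Q111 n k) x (t * (1 - x)) =
      (2 * real n - 1) * (2 * real k - 1) * (x * ((1 - x) ^ (k - 1) * (1 - x)) * (1 - t) * t *
        poly (jacobi_shift (2 * real k - 1) 1 (n - k - 1)) x * poly (jacobi_shift 1 1 (k - 2)) t)"
    unfolding eval2_simps eval2_Q111_inner[OF x assms] k(8) by (simp only: mult_ac of_nat_numeral)
  show "eval2 ((2 * of_nat n - 1) * (2 * of_nat k - 1) * Q111 n k) x (t * (1 - x)) =
      eval2 (- ((of_nat n + of_nat k) * (of_nat k - 1) * Q110 n k)
        - (of_nat n - of_nat k) * (of_nat k - 1) * Q110 n (k - 1)
        + (if k = n - 1 then 0 else (of_nat n - of_nat k) * (of_nat k - 1) * Q110 (n - 1) k)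
        + (of_nat n + of_nat k - 2) * (of_nat k - 1) * Q110 (n - 1) (k - 1)) x (t * (1 - x))"
  proof (cases "k = n - 1")
    case True
    show ?thesis
      unfolding lhs key if_P[OF True] unfolding eval2_simps
      by (simp only: eval2_Q110_inner[OF x] k assms) algebra
  next
    case False
    show ?thesis
      unfolding lhs key if_not_P[OF False] unfolding eval2_simps
      by (simp only: eval2_Q110_inner[OF x] k assms False not_False_eq_True) algebra
  qed
qed

lemma Q111_diag_Q110:
  assumes "n \<ge> 2"
  shows "(2 * of_nat n - 1) * Q111 n n =
    (of_nat n - 1) * (- Q110 n n - Q110 n (n - 1) + Q110 (n - 1) (n - 1))"
proof (rule eval2_eqI)
  fix x t :: real
  assume x: "x \<noteq> 1"
  have n: "n \<ge> 1" "n - 1 \<ge> 1" "n - 1 < n" "n - (n - 1) - 1 = 0" "(1 - x) ^ n = (1 - x) ^ (n - 1) * (1 - x)"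
    using assms by (auto simp flip: power_Suc2)
  show "eval2 ((2 * of_nat n - 1) * Q111 n n) x (t * (1 - x)) =
      eval2 ((of_nat n - 1) * (- Q110 n n - Q110 n (n - 1) + Q110 (n - 1) (n - 1))) x (t * (1 - x))"
    using arg_cong[OF jacobi_shift_1_1_times_one_minus_t[OF assms, of t],
        of "\<lambda>r. (1 - x) ^ (n - 1) * (1 - x) * t * r"]
    unfolding eval2_simps eval2_Q111_diag[OF x assms]
    by (simp only: eval2_Q110_inner[OF x] eval2_Q110_diag[OF x] n jacobi_shift_0 poly_1) (simp add: algebra_simps)
qed

section \<open>Collecting the identities\<close>

theorem corollaryC3:
  shows "(Q111 0 0 = Q011 0 0 \<and>
     Q111 1 0 = 2 * Q011 1 0 - Q011 0 0 \<and>
     Q111 1 1 = Q011 1 1 \<and>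
     (\<forall>n\<ge>2. (2 * of_nat n - 1) * Q111 n 0
        = (of_nat n - 1) * (Q011 n 0 + Q011 (n - 1) 0)) \<and>
     (\<forall>n\<ge>2. \<forall>k. 1 \<le> k \<and> k \<le> n - 1 \<longrightarrow>
        (2 * of_nat n - 1) * Q111 n k
        = (of_nat n - of_nat k) * (Q011 n k + Q011 (n - 1) k)) \<and>
     (\<forall>n\<ge>2. Q111 n n = Q011 n n))
   \<and>
    (Q111 0 0 = Q101 0 0 \<and>
     Q111 1 0 = - 2 * Q101 1 0 + Q101 0 0 \<and>
     Q111 1 1 = 2 * Q101 1 1 + Q101 1 0 - Q101 0 0 \<and>
     (\<forall>n\<ge>2. (2 * of_nat n - 1) * Q111 n 0
        = (of_nat n - 1) * (- Q101 n 0 + Q101 (n - 1) 0)) \<and>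
     (\<forall>n\<ge>2. (2 * of_nat n - 1) * Q111 n 1
        = 2 * (of_nat n + 1) * Q101 n 1 + (of_nat n - 1) * Q101 n 0
          - (if n = 2 then 0 else 2 * (of_nat n - 1) * Q101 (n - 1) 1)
          - (of_nat n - 1) * Q101 (n - 1) 0) \<and>
     (\<forall>n k. 2 \<le> k \<and> k \<le> n - 1 \<longrightarrow>
        (2 * of_nat n - 1) * (2 * of_nat k - 1) * Q111 n k
        = (of_nat n + of_nat k) * (of_nat k - 1) * Q101 n k
          - (of_nat n - of_nat k) * (of_nat k - 1) * Q101 n (k - 1)
          - (if k = n - 1 then 0
             else (of_nat n - of_nat k) * (of_nat k - 1) * Q101 (n - 1) k)
          + (of_nat n + of_nat k - 2) * (of_nat k - 1) * Q101 (n - 1) (k - 1)) \<and>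
     (\<forall>n\<ge>2. (2 * of_nat n - 1) * Q111 n n
        = (of_nat n - 1) * (Q101 n n - Q101 n (n - 1) + Q101 (n - 1) (n - 1))))
   \<and>
    (Q111 0 0 = Q110 0 0 \<and>
     Q111 1 0 = - 2 * Q110 1 0 + Q110 0 0 \<and>
     Q111 1 1 = - 2 * Q110 1 1 - Q110 1 0 + Q110 0 0 \<and>
     (\<forall>n\<ge>2. (2 * of_nat n - 1) * Q111 n 0
        = (of_nat n - 1) * (- Q110 n 0 + Q110 (n - 1) 0)) \<and>
     (\<forall>n\<ge>2. (2 * of_nat n - 1) * Q111 n 1
        = - 2 * (of_nat n + 1) * Q110 n 1 - (of_nat n - 1) * Q110 n 0
          + (if n = 2 then 0 else 2 * (of_nat n - 1) * Q110 (n - 1) 1)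
          + (of_nat n - 1) * Q110 (n - 1) 0) \<and>
     (\<forall>n k. 2 \<le> k \<and> k \<le> n - 1 \<longrightarrow>
        (2 * of_nat n - 1) * (2 * of_nat k - 1) * Q111 n k
        = - ((of_nat n + of_nat k) * (of_nat k - 1) * Q110 n k)
          - (of_nat n - of_nat k) * (of_nat k - 1) * Q110 n (k - 1)
          + (if k = n - 1 then 0
             else (of_nat n - of_nat k) * (of_nat k - 1) * Q110 (n - 1) k)
          + (of_nat n + of_nat k - 2) * (of_nat k - 1) * Q110 (n - 1) (k - 1)) \<and>
     (\<forall>n\<ge>2. (2 * of_nat n - 1) * Q111 n n
        = (of_nat n - 1) * (- Q110 n n - Q110 n (n - 1) + Q110 (n - 1) (n - 1))))"
proof -
  \<comment> \<open>For n <= 1 every Jacobi factor has degree 0, so the elements are explicit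
    polynomials.\<close>
  have Q011_small: "Q111 0 0 = Q011 0 0" "Q111 1 0 = 2 * Q011 1 0 - Q011 0 0" "Q111 1 1 = Q011 1 1"
    by (simp_all add: Q111_def Q011_def tri_0 one_pCons [symmetric])
  have Q101_small: "Q111 0 0 = Q101 0 0" "Q111 1 0 = - 2 * Q101 1 0 + Q101 0 0"
      "Q111 1 1 = 2 * Q101 1 1 + Q101 1 0 - Q101 0 0"
    by (simp_all add: Q111_def Q101_def tri_0 Z_def one_pCons [symmetric])
  have Q110_small: "Q111 0 0 = Q110 0 0" "Q111 1 0 = - 2 * Q110 1 0 + Q110 0 0"
      "Q111 1 1 = - 2 * Q110 1 1 - Q110 1 0 + Q110 0 0"
    by (simp_all add: Q111_def Q110_def tri_0 one_pCons [symmetric])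
  \<comment> \<open>The cases k = 1 and k >= 2 have different defining formulas but satisfy the same
    identity.\<close>
  have Q011_inner: "(2 * of_nat n - 1) * Q111 n k = (of_nat n - of_nat k) * (Q011 n k + Q011 (n - 1) k)"
    if "n \<ge> 2" "1 \<le> k \<and> k \<le> n - 1" for n k
    using that Q111_1_Q011[of n] Q111_inner_Q011[of k n] by (cases "k = 1") auto
  have less: "k < n" if "2 \<le> k \<and> k \<le> n - 1" for k n :: nat
    using that by linarith
  show ?thesis
    by (intro conjI allI impI)
      (fact Q011_small Q101_small Q110_small
        | (rule Q111_0_Q011 Q011_inner Q111_diag_Q011 Q111_0_Q101 Q111_1_Q101 Q111_diag_Q101
            Q111_0_Q110 Q111_1_Q110 Q111_diag_Q110; assumption)
        | (rule Q111_inner_Q101 Q111_inner_Q110; simp add: less))+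
qed

end
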